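(* The complete $\mathcal{L}_{\log}$-theory $T_{\log}$ is not strongly dependent. Therefore it is not $\mathrm{DP}$-minimal and does not have finite $\mathrm{DP}$-rank.
   Context: Let $\mathcal{L}_{\log}=\{0,+,-,<,\psi,\infty,s,p,\delta_1,\delta_2,\ldots\}$. An asymptotic couple is $(\Gamma,\psi)$ with $\Gamma$ an ordered abelian group, $\psi:\Gamma\setminus\{0\}\to\Gamma$ with, for nonzero $\alpha,\beta$: $\alpha+\beta\ne0\Rightarrow\psi(\alpha+\beta)\ge\min(\psi(\alpha),\psi(\beta))$; $\psi(k\alpha)=\psi(\alpha)$ for nonzero integers $k$; $\alpha>0\Rightarrow\alpha+\psi(\alpha)>\psi(\beta)$; $H$-type: $0<\alpha\le\beta\Rightarrow\psi(\alpha)\ge\psi(\beta)$. $\psi(0)=\infty$, $\Psi=\psi(\Gamma\setminus\{0\})$, $\alpha'=\alpha+\psi(\alpha)$; asymptotic integration: each $\gamma$ equals $\alpha'$ for a unique $\alpha\neq0$, written $\int\gamma$; $s(\gamma)=\psi(\int\gamma)$. Models of $T_{\log}$: divisible $H$-asymptotic couples with asymptotic integration such that $\Psi$ has least element $s(0)>0$, each $\alpha\in\Psi$ has immediate successor $s(\alpha)$ in $\Psi$, and $s:\Psi\to\Psi^{>s(0)}$ is a bijection; $p$ is its inverse on $\Psi^{>s(0)}$ and $\infty$ elsewhere; underlying set $\Gamma\cup\{\infty\}$, $\Gamma<\infty$, $\delta_n$ division by $n$, $\infty$ default value of all functions. $T_{\log}$ is complete (it is the theory of the asymptotic couple of the field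 of logarithmic transseries). *)

theory Defs
  imports Main "HOL-Library.Extended_Nat"
begin

section \<open>First-order logic\<close>

datatype 'f trm = Var nat | Fn 'f "'f trm list"

datatype ('f, 'r) fm =
    Eq "'f trm" "'f trm"
  | Rel 'r "'f trm list"
  | Neg "('f, 'r) fm"
  | Conj "('f, 'r) fm" "('f, 'r) fm"
  | Exi nat "('f, 'r) fm"

record ('f, 'r) language =
  fun_arity :: "'f \<Rightarrow> nat"
  rel_arity :: "'r \<Rightarrow> nat"

record ('f, 'r, 'u) struct =
  dom :: "'u set"
  fun_interp :: "'f \<Rightarrow> 'u list \<Rightarrow> 'u"
  rel_interp :: "'r \<Rightarrow> 'u list \<Rightarrow> bool"

primrec wf_trm :: "('f, 'r) language \<Rightarrow> 'f trm \<Rightarrow> bool" where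
  "wf_trm L (Var v) \<longleftrightarrow> True"
| "wf_trm L (Fn f ts) \<longleftrightarrow> length ts = fun_arity L f \<and> list_all (wf_trm L) ts"

primrec wf_fm :: "('f, 'r) language \<Rightarrow> ('f, 'r) fm \<Rightarrow> bool" where
  "wf_fm L (Eq t u) \<longleftrightarrow> wf_trm L t \<and> wf_trm L u"
| "wf_fm L (Rel r ts) \<longleftrightarrow> length ts = rel_arity L r \<and> list_all (wf_trm L) ts"
| "wf_fm L (Neg A) \<longleftrightarrow> wf_fm L A"
| "wf_fm L (Conj A B) \<longleftrightarrow> wf_fm L A \<and> wf_fm L B"
| "wf_fm L (Exi v A) \<longleftrightarrow> wf_fm L A"

primrec fv_trm :: "'f trm \<Rightarrow> nat set" where
  "fv_trm (Var v) = {v}"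
| "fv_trm (Fn f ts) = \<Union> (set (map fv_trm ts))"

primrec fv_fm :: "('f, 'r) fm \<Rightarrow> nat set" where
  "fv_fm (Eq t u) = fv_trm t \<union> fv_trm u"
| "fv_fm (Rel r ts) = \<Union> (set (map fv_trm ts))"
| "fv_fm (Neg A) = fv_fm A"
| "fv_fm (Conj A B) = fv_fm A \<union> fv_fm B"
| "fv_fm (Exi v A) = fv_fm A - {v}"

primrec val :: "('f, 'r, 'u) struct \<Rightarrow> (nat \<Rightarrow> 'u) \<Rightarrow> 'f trm \<Rightarrow> 'u" where
  "val M e (Var v) = e v"
| "val M e (Fn f ts) = fun_interp M f (map (val M e) ts)"

primrec sat :: "('f, 'r, 'u) struct \<Rightarrow> (nat \<Rightarrow> 'u) \<Rightarrow> ('f, 'r) fm \<Rightarrow> bool" where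
  "sat M e (Eq t u) \<longleftrightarrow> val M e t = val M e u"
| "sat M e (Rel r ts) \<longleftrightarrow> rel_interp M r (map (val M e) ts)"
| "sat M e (Neg A) \<longleftrightarrow> \<not> sat M e A"
| "sat M e (Conj A B) \<longleftrightarrow> sat M e A \<and> sat M e B"
| "sat M e (Exi v A) \<longleftrightarrow> (\<exists>d\<in>dom M. sat M (e(v := d)) A)"

definition is_struct :: "('f, 'r) language \<Rightarrow> ('f, 'r, 'u) struct \<Rightarrow> bool" where
  "is_struct L M \<longleftrightarrow> dom M \<noteq> {} \<and>
     (\<forall>f xs. length xs = fun_arity L f \<and> set xs \<subseteq> dom M \<longrightarrow> fun_interp M f xs \<in> dom M)"

text \<open>A theory is a set of sentences.\<close>

definition is_model ::
  "('f, 'r) language \<Rightarrow> ('f, 'r, 'u) struct \<Rightarrow> ('f, 'r) fm set \<Rightarrow> bool" where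
  "is_model L M T \<longleftrightarrow> is_struct L M \<and>
     (\<forall>A\<in>T. \<forall>e. range e \<subseteq> dom M \<longrightarrow> sat M e A)"


section \<open>Types, ict-patterns, dp-rank and strong dependence\<close>

text \<open>
  A partial type in \<open>m\<close> variables with parameters from \<open>M\<close> is a set of pairs \<open>(A, c)\<close>, standing
  for the formula \<open>A(x, c)\<close>: the variables \<open>0, \<dots>, m - 1\<close> of \<open>A\<close> form the tuple \<open>x\<close>, and the
  following \<open>length c\<close> variables are replaced by the parameter tuple \<open>c\<close>.  It is consistent if it is
  finitely satisfiable in \<open>M\<close>, that is, realised in some elementary extension of \<open>M\<close>.
\<close>

definition consistent_type ::
  "('f, 'r, 'u) struct \<Rightarrow> nat \<Rightarrow> (('f, 'r) fm \<times> 'u list) set \<Rightarrow> bool" where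
  "consistent_type M m p \<longleftrightarrow>
     (\<forall>q. finite q \<and> q \<subseteq> p \<longrightarrow>
        (\<exists>b. length b = m \<and> set b \<subseteq> dom M \<and> (\<forall>(A, c)\<in>q. sat M ((!) (b @ c)) A)))"

text \<open>
  An ict-pattern of depth \<open>\<kappa>\<close> (with \<open>\<kappa> = \<infinity>\<close> for depth \<open>\<omega>\<close>): formulas \<open>\<phi> i (x, y\<^sub>i)\<close>, one for each row
  \<open>i < \<kappa>\<close>, with \<open>length x = m\<close> and \<open>length y\<^sub>i = k i\<close>, and tuples \<open>a i j\<close> for \<open>i < \<kappa>\<close>, \<open>j < \<omega>\<close>, such that
  for every path \<open>\<eta>\<close> the set of all \<open>\<phi> i (x, a i (\<eta> i))\<close> and all \<open>\<not> \<phi> i (x, a i j)\<close>, \<open>j \<noteq> \<eta> i\<close>,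
  is consistent.
\<close>

definition ict_pattern ::
  "('f, 'r) language \<Rightarrow> ('f, 'r, 'u) struct \<Rightarrow> nat \<Rightarrow> enat \<Rightarrow>
   (nat \<Rightarrow> ('f, 'r) fm) \<Rightarrow> (nat \<Rightarrow> nat) \<Rightarrow> (nat \<Rightarrow> nat \<Rightarrow> 'u list) \<Rightarrow> bool" where
  "ict_pattern L M m \<kappa> \<phi> k a \<longleftrightarrow>
     (\<forall>i. enat i < \<kappa> \<longrightarrow> wf_fm L (\<phi> i) \<and> fv_fm (\<phi> i) \<subseteq> {..<m + k i} \<and>
        (\<forall>j. length (a i j) = k i \<and> set (a i j) \<subseteq> dom M)) \<and>
     (\<forall>\<eta> :: nat \<Rightarrow> nat. consistent_type M m
        ({(\<phi> i, a i (\<eta> i)) | i. enat i < \<kappa>} \<union>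
         {(Neg (\<phi> i), a i j) | i j. enat i < \<kappa> \<and> j \<noteq> \<eta> i}))"

text \<open>
  HOL cannot quantify over all models of a theory inside a formula, so the following notions carry
  the type \<open>'u\<close> from which the elements of the models are drawn.  For a countable language the
  choice is immaterial as long as \<open>'u\<close> is infinite: a pattern has countably many parameters and
  consistency of a type is preserved by passing to an elementary substructure containing them, so by
  Loewenheim-Skolem a pattern in some model of the theory yields one of the same depth in a model
  with countable domain.
\<close>

definition has_ict_pattern ::
  "'u itself \<Rightarrow> ('f, 'r) language \<Rightarrow> ('f, 'r) fm set \<Rightarrow> nat \<Rightarrow> enat \<Rightarrow> bool" where
  "has_ict_pattern U L T m \<kappa> \<longleftrightarrow>
     (\<exists>(M :: ('f, 'r, 'u) struct) \<phi> k a. is_model L M T \<and> ict_pattern L M m \<kappa> \<phi> k a)"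

definition strongly_dependent ::
  "'u itself \<Rightarrow> ('f, 'r) language \<Rightarrow> ('f, 'r) fm set \<Rightarrow> bool" where
  "strongly_dependent U L T \<longleftrightarrow> (\<forall>m. \<not> has_ict_pattern U L T m \<infinity>)"

text \<open>The dp-rank of the type \<open>x = x\<close>, for a single variable \<open>x\<close>, is at most \<open>n\<close>.\<close>

definition dp_rank_le ::
  "'u itself \<Rightarrow> ('f, 'r) language \<Rightarrow> ('f, 'r) fm set \<Rightarrow> nat \<Rightarrow> bool" where
  "dp_rank_le U L T n \<longleftrightarrow> \<not> has_ict_pattern U L T 1 (enat (Suc n))"

definition dp_minimal ::
  "'u itself \<Rightarrow> ('f, 'r) language \<Rightarrow> ('f, 'r) fm set \<Rightarrow> bool" where
  "dp_minimal U L T \<longleftrightarrow> dp_rank_le U L T 1"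

definition finite_dp_rank ::
  "'u itself \<Rightarrow> ('f, 'r) language \<Rightarrow> ('f, 'r) fm set \<Rightarrow> bool" where
  "finite_dp_rank U L T \<longleftrightarrow> (\<exists>n. dp_rank_le U L T n)"


section \<open>The language of logarithmic asymptotic couples\<close>

text \<open>\<open>F_delta n\<close> is the symbol for division by \<open>Suc n\<close>.\<close>

datatype log_fun = F_zero | F_plus | F_minus | F_psi | F_infty | F_s | F_p | F_delta nat

datatype log_rel = R_less

fun log_fun_arity :: "log_fun \<Rightarrow> nat" where
  "log_fun_arity F_zero = 0"
| "log_fun_arity F_infty = 0"
| "log_fun_arity F_plus = 2"
| "log_fun_arity _ = 1"

definition L_log :: "(log_fun, log_rel) language" where
  "L_log = \<lparr>fun_arity = log_fun_arity, rel_arity = (\<lambda>_. 2)\<rparr>"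

type_synonym ltrm = "log_fun trm"
type_synonym lfm = "(log_fun, log_rel) fm"

abbreviation t_zero :: ltrm ("\<zero>") where "\<zero> \<equiv> Fn F_zero []"
abbreviation t_infty :: ltrm ("\<^bold>\<infinity>") where "\<^bold>\<infinity> \<equiv> Fn F_infty []"
abbreviation t_plus :: "ltrm \<Rightarrow> ltrm \<Rightarrow> ltrm" (infixl "\<oplus>" 65) where "t \<oplus> u \<equiv> Fn F_plus [t, u]"
abbreviation t_minus :: "ltrm \<Rightarrow> ltrm" where "t_minus t \<equiv> Fn F_minus [t]"
abbreviation t_psi :: "ltrm \<Rightarrow> ltrm" where "t_psi t \<equiv> Fn F_psi [t]"
abbreviation t_s :: "ltrm \<Rightarrow> ltrm" where "t_s t \<equiv> Fn F_s [t]"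
abbreviation t_p :: "ltrm \<Rightarrow> ltrm" where "t_p t \<equiv> Fn F_p [t]"
abbreviation t_delta :: "nat \<Rightarrow> ltrm \<Rightarrow> ltrm" where "t_delta n t \<equiv> Fn (F_delta n) [t]"

primrec t_mult :: "nat \<Rightarrow> ltrm \<Rightarrow> ltrm" where
  "t_mult 0 t = \<zero>"
| "t_mult (Suc n) t = t_mult n t \<oplus> t"

abbreviation f_eq :: "ltrm \<Rightarrow> ltrm \<Rightarrow> lfm" (infix "\<^bold>=" 50) where "t \<^bold>= u \<equiv> Eq t u"
abbreviation f_neq :: "ltrm \<Rightarrow> ltrm \<Rightarrow> lfm" (infix "\<^bold>\<noteq>" 50) where "t \<^bold>\<noteq> u \<equiv> Neg (Eq t u)"
abbreviation f_less :: "ltrm \<Rightarrow> ltrm \<Rightarrow> lfm" (infix "\<^bold><" 50) where "t \<^bold>< u \<equiv> Rel R_less [t, u]"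
abbreviation f_and :: "lfm \<Rightarrow> lfm \<Rightarrow> lfm" (infixr "\<^bold>\<and>" 35) where "A \<^bold>\<and> B \<equiv> Conj A B"
abbreviation f_or :: "lfm \<Rightarrow> lfm \<Rightarrow> lfm" (infixr "\<^bold>\<or>" 30) where
  "A \<^bold>\<or> B \<equiv> Neg (Conj (Neg A) (Neg B))"
abbreviation f_imp :: "lfm \<Rightarrow> lfm \<Rightarrow> lfm" (infixr "\<^bold>\<longrightarrow>" 25) where
  "A \<^bold>\<longrightarrow> B \<equiv> Neg (Conj A (Neg B))"
abbreviation f_le :: "ltrm \<Rightarrow> ltrm \<Rightarrow> lfm" (infix "\<^bold>\<le>" 50) where "t \<^bold>\<le> u \<equiv> (t \<^bold>< u \<^bold>\<or> t \<^bold>= u)"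
abbreviation f_all :: "nat \<Rightarrow> lfm \<Rightarrow> lfm" where "f_all v A \<equiv> Neg (Exi v (Neg A))"

text \<open>Quantifiers over \<open>\<Gamma>\<close> and over \<open>\<Gamma> \<setminus> {0}\<close>.\<close>

abbreviation all_\<Gamma> :: "nat \<Rightarrow> lfm \<Rightarrow> lfm" where
  "all_\<Gamma> v A \<equiv> f_all v (Var v \<^bold>\<noteq> \<^bold>\<infinity> \<^bold>\<longrightarrow> A)"
abbreviation all_\<Gamma>0 :: "nat \<Rightarrow> lfm \<Rightarrow> lfm" where
  "all_\<Gamma>0 v A \<equiv> f_all v (Var v \<^bold>\<noteq> \<^bold>\<infinity> \<^bold>\<and> Var v \<^bold>\<noteq> \<zero> \<^bold>\<longrightarrow> A)"
abbreviation ex_\<Gamma>0 :: "nat \<Rightarrow> lfm \<Rightarrow> lfm" where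
  "ex_\<Gamma>0 v A \<equiv> Exi v ((Var v \<^bold>\<noteq> \<^bold>\<infinity> \<^bold>\<and> Var v \<^bold>\<noteq> \<zero>) \<^bold>\<and> A)"

text \<open>Membership in \<open>\<Psi>\<close>; the variable 9 must not occur in the term.\<close>

abbreviation in_\<Psi> :: "ltrm \<Rightarrow> lfm" where
  "in_\<Psi> t \<equiv> ex_\<Gamma>0 9 (t_psi (Var 9) \<^bold>= t)"

abbreviation "X \<equiv> Var 0 :: ltrm"
abbreviation "Y \<equiv> Var 1 :: ltrm"
abbreviation "Z \<equiv> Var 2 :: ltrm"


section \<open>The theory of logarithmic asymptotic couples\<close>

text \<open>\<open>\<Gamma> \<union> {\<infinity>}\<close> is linearly ordered with \<open>\<Gamma> < \<infinity>\<close>, and \<open>\<Gamma>\<close> is an ordered abelian group.\<close>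

definition ax_ordered_group :: "lfm set" where
  "ax_ordered_group =
    {f_all 0 (Neg (X \<^bold>< X)),
     f_all 0 (f_all 1 (f_all 2 (X \<^bold>< Y \<^bold>\<and> Y \<^bold>< Z \<^bold>\<longrightarrow> X \<^bold>< Z))),
     f_all 0 (f_all 1 (X \<^bold>< Y \<^bold>\<or> X \<^bold>= Y \<^bold>\<or> Y \<^bold>< X)),
     all_\<Gamma> 0 (X \<^bold>< \<^bold>\<infinity>),
     \<zero> \<^bold>\<noteq> \<^bold>\<infinity>,
     all_\<Gamma> 0 (all_\<Gamma> 1 (X \<oplus> Y \<^bold>\<noteq> \<^bold>\<infinity>)),
     all_\<Gamma> 0 (t_minus X \<^bold>\<noteq> \<^bold>\<infinity>),
     all_\<Gamma> 0 (all_\<Gamma> 1 (all_\<Gamma> 2 ((X \<oplus> Y) \<oplus> Z \<^bold>= X \<oplus> (Y \<oplus> Z)))),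
     all_\<Gamma> 0 (all_\<Gamma> 1 (X \<oplus> Y \<^bold>= Y \<oplus> X)),
     all_\<Gamma> 0 (X \<oplus> \<zero> \<^bold>= X),
     all_\<Gamma> 0 (X \<oplus> t_minus X \<^bold>= \<zero>),
     all_\<Gamma> 0 (all_\<Gamma> 1 (all_\<Gamma> 2 (X \<^bold>< Y \<^bold>\<longrightarrow> X \<oplus> Z \<^bold>< Y \<oplus> Z)))}"

definition ax_infty_default :: "lfm set" where
  "ax_infty_default =
    {f_all 0 (X \<oplus> \<^bold>\<infinity> \<^bold>= \<^bold>\<infinity>),
     f_all 0 (\<^bold>\<infinity> \<oplus> X \<^bold>= \<^bold>\<infinity>),
     t_minus \<^bold>\<infinity> \<^bold>= \<^bold>\<infinity>,
     t_psi \<zero> \<^bold>= \<^bold>\<infinity>,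
     t_psi \<^bold>\<infinity> \<^bold>= \<^bold>\<infinity>,
     t_s \<^bold>\<infinity> \<^bold>= \<^bold>\<infinity>,
     t_p \<^bold>\<infinity> \<^bold>= \<^bold>\<infinity>} \<union>
    {t_delta n \<^bold>\<infinity> \<^bold>= \<^bold>\<infinity> | n. True}"

definition ax_divisible :: "lfm set" where
  "ax_divisible =
    (\<Union>n. {all_\<Gamma> 0 (t_delta n X \<^bold>\<noteq> \<^bold>\<infinity>),
           all_\<Gamma> 0 (t_mult (Suc n) (t_delta n X) \<^bold>= X)})"

definition ax_H_asymptotic_couple :: "lfm set" where
  "ax_H_asymptotic_couple =
    {all_\<Gamma>0 0 (t_psi X \<^bold>\<noteq> \<^bold>\<infinity>),
     all_\<Gamma>0 0 (all_\<Gamma>0 1 (X \<oplus> Y \<^bold>\<noteq> \<zero> \<^bold>\<longrightarrow>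
       (t_psi X \<^bold>\<le> t_psi (X \<oplus> Y) \<^bold>\<or> t_psi Y \<^bold>\<le> t_psi (X \<oplus> Y)))),
     all_\<Gamma>0 0 (all_\<Gamma>0 1 (\<zero> \<^bold>< X \<^bold>\<longrightarrow> t_psi Y \<^bold>< X \<oplus> t_psi X)),
     all_\<Gamma>0 0 (all_\<Gamma>0 1 (\<zero> \<^bold>< X \<^bold>\<and> X \<^bold>\<le> Y \<^bold>\<longrightarrow> t_psi Y \<^bold>\<le> t_psi X))} \<union>
    (\<Union>n. {all_\<Gamma>0 0 (t_psi (t_mult (Suc n) X) \<^bold>= t_psi X),
           all_\<Gamma>0 0 (t_psi (t_minus (t_mult (Suc n) X)) \<^bold>= t_psi X)})"

definition ax_asymptotic_integration :: "lfm set" where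
  "ax_asymptotic_integration =
    {all_\<Gamma> 0 (ex_\<Gamma>0 1 (Y \<oplus> t_psi Y \<^bold>= X \<^bold>\<and>
       all_\<Gamma>0 2 (Z \<oplus> t_psi Z \<^bold>= X \<^bold>\<longrightarrow> Z \<^bold>= Y))),
     all_\<Gamma> 0 (all_\<Gamma>0 1 (Y \<oplus> t_psi Y \<^bold>= X \<^bold>\<longrightarrow> t_s X \<^bold>= t_psi Y))}"

definition ax_\<Psi> :: "lfm set" where
  "ax_\<Psi> =
    {in_\<Psi> (t_s \<zero>),
     f_all 0 (in_\<Psi> X \<^bold>\<longrightarrow> t_s \<zero> \<^bold>\<le> X),
     \<zero> \<^bold>< t_s \<zero>,
     f_all 0 (in_\<Psi> X \<^bold>\<longrightarrow> in_\<Psi> (t_s X) \<^bold>\<and> X \<^bold>< t_s X \<^bold>\<and>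
       f_all 1 (in_\<Psi> Y \<^bold>\<and> X \<^bold>< Y \<^bold>\<longrightarrow> t_s X \<^bold>\<le> Y)),
     f_all 0 (in_\<Psi> X \<^bold>\<longrightarrow> in_\<Psi> (t_s X) \<^bold>\<and> t_s \<zero> \<^bold>< t_s X),
     f_all 0 (f_all 1 (in_\<Psi> X \<^bold>\<and> in_\<Psi> Y \<^bold>\<and> t_s X \<^bold>= t_s Y \<^bold>\<longrightarrow> X \<^bold>= Y)),
     f_all 0 (in_\<Psi> X \<^bold>\<and> t_s \<zero> \<^bold>< X \<^bold>\<longrightarrow> Exi 1 (in_\<Psi> Y \<^bold>\<and> t_s Y \<^bold>= X)),
     f_all 0 (in_\<Psi> X \<^bold>\<and> t_s \<zero> \<^bold>< X \<^bold>\<longrightarrow> in_\<Psi> (t_p X) \<^bold>\<and> t_s (t_p X) \<^bold>= X),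
     f_all 0 (Neg (in_\<Psi> X \<^bold>\<and> t_s \<zero> \<^bold>< X) \<^bold>\<longrightarrow> t_p X \<^bold>= \<^bold>\<infinity>)}"

definition T_log :: "lfm set" where
  "T_log = ax_ordered_group \<union> ax_infty_default \<union> ax_divisible \<union> ax_H_asymptotic_couple \<union>
     ax_asymptotic_integration \<union> ax_\<Psi>"

lemma fv_t_mult: "fv_trm (t_mult n t) \<subseteq> fv_trm t" by (induction n) auto

lemma wf_t_mult: "wf_trm L_log t \<Longrightarrow> wf_trm L_log (t_mult n t)"
  by (induction n) (auto simp: L_log_def)

lemma T_log_sentences: "A \<in> T_log \<Longrightarrow> wf_fm L_log A \<and> fv_fm A = {}"
  using fv_t_mult wf_t_mult
  unfolding T_log_def ax_ordered_group_def ax_infty_default_def ax_divisible_def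
    ax_H_asymptotic_couple_def ax_asymptotic_integration_def ax_\<Psi>_def
  by (fastforce simp: L_log_def)

end

theory Submission
  imports Defs "HOL-Library.Product_Lexorder" "HOL-Library.Countable"
begin

text \<open>
  Let \<open>I\<close> be a countable linear order of type \<open>\<omega> + \<zeta>\<cdot>\<omega>\<close>, and let \<open>\<Gamma>\<close> be the lexicographically ordered
  \<open>\<rat>\<close>-span of the indicators \<open>b i\<close> of the initial segments \<open>{..i}\<close> in \<open>I \<Rightarrow> \<rat>\<close>. These step functions
  have a least support element whenever they are nonzero, so \<open>\<psi> g = b (lead g)\<close> makes sense; then
  \<open>\<Psi> = {b i | i}\<close>, and the integral of \<open>g\<close> is \<open>g - b n\<close> for the least \<open>n\<close> with \<open>g n \<noteq> 1\<close>. This is a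
  model of \<open>T_log\<close>.

  If the leading coefficient of \<open>x\<close> is \<open>1\<close>, then \<open>x \<mapsto> x - (\<psi> x - p (\<psi> x))\<close> deletes the leading term.
  Hence for a sum \<open>x\<close> of unit vectors the \<open>i\<close>-th smallest support element is definable from \<open>x\<close>, uniformly
  in \<open>x\<close>, and the formula saying that it equals \<open>y\<close> is the \<open>i\<close>-th row of an ict-pattern: the parameters
  of row \<open>i\<close> come from the \<open>i\<close>-th copy of \<open>\<zeta>\<close>, so that rows are ordered like their indices. In the
  standard model, where \<open>\<Psi>\<close> has type \<open>\<omega>\<close>, infinite rows could not be ordered in this way.
\<close>

section \<open>The index order\<close>

text \<open>The bound cuts the copy of \<zeta> at first component 0 down to \<omega>: there is a
  least element, every other element has a predecessor, and none is largest.\<close>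

typedef idx = "{k :: nat \<times> int. (0, 0) \<le> k}"
  by auto

setup_lifting type_definition_idx

instantiation idx :: linorder
begin

lift_definition less_eq_idx :: "idx \<Rightarrow> idx \<Rightarrow> bool" is "(\<le>)" .
lift_definition less_idx :: "idx \<Rightarrow> idx \<Rightarrow> bool" is "(<)" .

instance
  by standard (transfer; auto)+

end

instance idx :: countable
  by (rule countable_classI[of "to_nat \<circ> Rep_idx"]) (simp add: Rep_idx_inject)

lift_definition idx_zero :: idx is "(0, 0)" by simp

lift_definition idx_suc :: "idx \<Rightarrow> idx" is "\<lambda>(i, z). (i, z + 1)" by auto

text \<open>\<open>Suc i\<close> skips the initial \<omega>, so every cell has a
  predecessor.\<close>

lift_definition idx_cell :: "nat \<Rightarrow> nat \<Rightarrow> idx" is "\<lambda>i j. (Suc i, int j)" by auto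

lemma idx_zero_le [simp]: "idx_zero \<le> k"
  by transfer auto

lemma not_less_idx_zero [simp]: "\<not> k < idx_zero"
  by (simp add: not_less)

lemma le_idx_zero_iff [simp]: "k \<le> idx_zero \<longleftrightarrow> k = idx_zero"
  by (auto intro: antisym)

lemma idx_suc_le_iff: "idx_suc k \<le> l \<longleftrightarrow> k < l"
  by transfer auto

lemma less_idx_suc_iff: "l < idx_suc k \<longleftrightarrow> l \<le> k"
  by (meson idx_suc_le_iff linorder_not_le)

lemma le_idx_suc_iff: "l \<le> idx_suc k \<longleftrightarrow> l \<le> k \<or> l = idx_suc k"
  by (auto simp: less_idx_suc_iff order.order_iff_strict)

lemma less_idx_suc [simp]: "k < idx_suc k"
  by (simp add: less_idx_suc_iff)

lemma idx_suc_inject [simp]: "idx_suc k = idx_suc l \<longleftrightarrow> k = l"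
  by (metis antisym less_idx_suc_iff less_idx_suc)

lemma idx_suc_exhaust:
  assumes "k \<noteq> idx_zero"
  obtains l where "k = idx_suc l"
proof -
  have "\<exists>l. k = idx_suc l"
    using assms
  proof transfer
    fix k :: "nat \<times> int"
    assume "(0, 0) \<le> k" "k \<noteq> (0, 0)"
    then show "\<exists>l\<in>{k. (0, 0) \<le> k}. k = (case l of (i, z) \<Rightarrow> (i, z + 1))"
      by (intro bexI[of _ "(fst k, snd k - 1)"]) (auto simp: less_eq_prod_def prod_eq_iff split: prod.splits)
  qed
  then show thesis using that by blast
qed

lemma idx_zero_neq_suc [simp]: "idx_zero \<noteq> idx_suc k"
  by (metis idx_zero_le less_idx_suc linorder_not_le)

lemma idx_cell_less: "i < i' \<Longrightarrow> idx_cell i j < idx_cell i' j'"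
  by transfer auto

lemma idx_cell_inject: "idx_cell i j = idx_cell i j' \<longleftrightarrow> j = j'"
  by transfer auto

lemma idx_cell_neq_zero: "idx_cell i j \<noteq> idx_zero"
  by transfer auto

section \<open>The ordered group of step functions\<close>

definition initial :: "idx \<Rightarrow> idx \<Rightarrow> rat" where
  "initial i k = (if k \<le> i then 1 else 0)"

definition combo :: "(rat \<times> idx) list \<Rightarrow> idx \<Rightarrow> rat" where
  "combo xs k = (\<Sum>(q, i)\<leftarrow>xs. q * initial i k)"

typedef lgrp = "range combo" morphisms coef Abs_lgrp
  by auto

setup_lifting type_definition_lgrp

lemma lgrp_eqI: "(\<And>k. coef g k = coef h k) \<Longrightarrow> g = h"
  by (simp add: coef_inject[symmetric] fun_eq_iff)

text \<open>Many lists represent the same function, so one is chosen for each.\<close>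

instance lgrp :: countable
proof (rule countable_classI[of "\<lambda>g. to_nat (SOME xs. coef g = combo xs)"])
  fix g h
  assume *: "to_nat (SOME xs. coef g = combo xs) = to_nat (SOME xs. coef h = combo xs)"
  have "coef g = combo (SOME xs. coef g = combo xs)" for g
    by (rule someI_ex) (use coef[of g] in auto)
  with * show "g = h"
    by (metis coef_inject to_nat_split)
qed

lemma combo_append: "combo (xs @ ys) k = combo xs k + combo ys k"
  by (simp add: combo_def)

lemma combo_scale: "combo (map (\<lambda>(q, i). (c * q, i)) xs) k = c * combo xs k"
  by (induction xs) (auto simp: combo_def algebra_simps)

lift_definition smul :: "rat \<Rightarrow> lgrp \<Rightarrow> lgrp" is "\<lambda>c f k. c * f k"
  using combo_scale by (metis (no_types, lifting) ext rangeE rangeI)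

lift_definition basis :: "idx \<Rightarrow> lgrp" is initial
proof -
  fix i
  have "initial i = combo [(1, i)]" by (auto simp: combo_def)
  then show "initial i \<in> range combo" by blast
qed

instantiation lgrp :: ab_group_add
begin

lift_definition zero_lgrp :: lgrp is "\<lambda>_. 0"
proof -
  have "(\<lambda>_. 0) = combo []" by (auto simp: combo_def)
  then show "(\<lambda>_. 0) \<in> range combo" by blast
qed

lift_definition plus_lgrp :: "lgrp \<Rightarrow> lgrp \<Rightarrow> lgrp" is "\<lambda>f g k. f k + g k"
  using combo_append by (metis (no_types, lifting) ext rangeE rangeI)

definition uminus_lgrp :: "lgrp \<Rightarrow> lgrp" where "- g = smul (-1) g"

definition minus_lgrp :: "lgrp \<Rightarrow> lgrp \<Rightarrow> lgrp" where "g - h = g + - (h :: lgrp)"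

instance
  by standard
    (auto simp: minus_lgrp_def uminus_lgrp_def plus_lgrp.rep_eq zero_lgrp.rep_eq smul.rep_eq
      intro!: lgrp_eqI)

end

lemma coef_simps [simp]:
  "coef 0 k = 0"
  "coef (g + h) k = coef g k + coef h k"
  "coef (- g) k = - coef g k"
  "coef (g - h) k = coef g k - coef h k"
  "coef (smul c g) k = c * coef g k"
  "coef (basis i) k = (if k \<le> i then 1 else 0)"
  by (simp_all add: zero_lgrp.rep_eq plus_lgrp.rep_eq uminus_lgrp_def minus_lgrp_def smul.rep_eq
      basis.rep_eq initial_def)

text \<open>The indicator of \<open>{..i}\<close> jumps only at \<open>idx_suc i\<close>, so a
  finite combination takes at \<open>k\<close> the value it has at the last breakpoint not above
  \<open>k\<close>.\<close>

lemma coef_piecewise_constant: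
  obtains R where "finite R" "\<And>k. \<exists>r\<in>R. r \<le> k \<and> coef g r = coef g k"
proof -
  obtain xs where xs: "coef g = combo xs" using coef[of g] by auto
  define B where "B = snd ` set xs"
  define R where "R = insert idx_zero (idx_suc ` B)"
  have "\<exists>r\<in>R. r \<le> k \<and> coef g r = coef g k" for k
  proof -
    define r where "r = Max {r \<in> R. r \<le> k}"
    have fin: "finite {r \<in> R. r \<le> k}" by (simp add: R_def B_def)
    moreover have "idx_zero \<in> {r \<in> R. r \<le> k}" by (simp add: R_def)
    ultimately have r: "r \<in> R" "r \<le> k"
      using Max_in[of "{r \<in> R. r \<le> k}"] unfolding r_def by blast+
    have "initial b r = initial b k" if "b \<in> B" for b
    proof (cases "b < k")
      case True
      then have "idx_suc b \<le> r"
        unfolding r_def using that by (intro Max_ge[OF fin]) (auto simp: R_def idx_suc_le_iff)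
      with True show ?thesis by (auto simp: initial_def idx_suc_le_iff)
    qed (use r in \<open>auto simp: initial_def\<close>)
    then have "coef g r = coef g k"
      unfolding xs combo_def by (intro arg_cong[of _ _ sum_list] map_cong) (auto simp: B_def split_beta)
    with r show ?thesis by blast
  qed
  moreover have "finite R" by (simp add: R_def B_def)
  ultimately show thesis using that by blast
qed

text \<open>\<open>idx\<close> is not well-ordered, but finitely many breakpoints suffice: a nonzero
  value at \<open>l\<close> is already taken at a breakpoint not above \<open>l\<close>.\<close>

lemma least_support:
  assumes "coef g k \<noteq> 0"
  obtains n where "n \<le> k" "coef g n \<noteq> 0" "\<And>l. l < n \<Longrightarrow> coef g l = 0"
proof -
  obtain R where R: "finite R" "\<And>k. \<exists>r\<in>R. r \<le> k \<and> coef g r = coef g k"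
    using coef_piecewise_constant[of g] by blast
  define S where "S = {r \<in> R. coef g r \<noteq> 0}"
  have S: "finite S" using R(1) by (simp add: S_def)
  have below: "\<exists>r\<in>S. r \<le> l" if "coef g l \<noteq> 0" for l
    using R(2)[of l] that by (auto simp: S_def)
  then have "S \<noteq> {}" using assms by blast
  show thesis
  proof
    show "Min S \<le> k" using below[OF assms] Min_le[OF S] by force
    show "coef g (Min S) \<noteq> 0" using Min_in[OF S \<open>S \<noteq> {}\<close>] by (simp add: S_def)
    show "coef g l = 0" if "l < Min S" for l
      using below[of l] Min_le[OF S] that by force
  qed
qed

section \<open>The lexicographic order on step functions\<close>

instantiation lgrp :: linordered_ab_group_add
begin

definition less_lgrp :: "lgrp \<Rightarrow> lgrp \<Rightarrow> bool" where
  "g < h \<longleftrightarrow> (\<exists>n. (\<forall>k<n. coef g k = coef h k) \<and> coef g n < coef h n)"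

definition less_eq_lgrp :: "lgrp \<Rightarrow> lgrp \<Rightarrow> bool" where
  "g \<le> h \<longleftrightarrow> g < h \<or> g = (h :: lgrp)"

instance
proof -
  have irrefl: "\<not> g < g" for g :: lgrp by (simp add: less_lgrp_def)
  have trans: "g < u" if gh: "g < h" and hu: "h < u" for g h u :: lgrp
  proof -
    obtain m where m: "\<forall>k<m. coef g k = coef h k" "coef g m < coef h m"
      using gh by (auto simp: less_lgrp_def)
    obtain n where n: "\<forall>k<n. coef h k = coef u k" "coef h n < coef u n"
      using hu by (auto simp: less_lgrp_def)
    have "\<forall>k<min m n. coef g k = coef u k" using m n by simp
    moreover have "coef g (min m n) < coef u (min m n)"
      using m n by (cases m n rule: linorder_cases) (auto simp: min_def)
    ultimately show ?thesis unfolding less_lgrp_def by blast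
  qed
  have linear: "g < h \<or> g = h \<or> h < g" for g h :: lgrp
  proof (cases "g = h")
    case False
    \<comment> \<open>The first difference of \<open>g\<close> and \<open>h\<close> is the least
      support element of \<open>g - h\<close>.\<close>
    then obtain k where "coef (g - h) k \<noteq> 0" using lgrp_eqI[of g h] by auto
    then obtain n where "coef (g - h) n \<noteq> 0" "\<And>l. l < n \<Longrightarrow> coef (g - h) l = 0"
      by (rule least_support) blast
    then have "\<forall>k<n. coef g k = coef h k" "coef g n < coef h n \<or> coef h n < coef g n" by auto
    then show ?thesis unfolding less_lgrp_def by metis
  qed simp
  show "OFCLASS(lgrp, linordered_ab_group_add_class)"
  proof
    fix g h u :: lgrp
    show "g < h \<longleftrightarrow> g \<le> h \<and> \<not> h \<le> g"
      using irrefl trans unfolding less_eq_lgrp_def by metis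
    show "g \<le> g" by (simp add: less_eq_lgrp_def)
    show "g \<le> h \<Longrightarrow> h \<le> u \<Longrightarrow> g \<le> u"
      using trans unfolding less_eq_lgrp_def by blast
    show "g \<le> h \<Longrightarrow> h \<le> g \<Longrightarrow> g = h"
      using irrefl trans unfolding less_eq_lgrp_def by blast
    show "g \<le> h \<or> h \<le> g" using linear unfolding less_eq_lgrp_def by blast
    show "g \<le> h \<Longrightarrow> u + g \<le> u + h" unfolding less_eq_lgrp_def less_lgrp_def by auto
  qed
qed

end

lemma lgrp_lessI: "(\<And>k. k < n \<Longrightarrow> coef g k = coef h k) \<Longrightarrow> coef g n < coef h n \<Longrightarrow> g < h"
  by (auto simp: less_lgrp_def)

lemma smul_Suc: "smul (of_nat (Suc n)) g = smul (of_nat n) g + g"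
  by (rule lgrp_eqI) (simp add: algebra_simps)

lemma basis_less_iff [simp]: "basis i < basis j \<longleftrightarrow> i < j"
proof -
  have less: "basis i < basis j" if "i < j" for i j
    by (rule lgrp_lessI[of "idx_suc i"]) (use that in \<open>auto simp: less_idx_suc_iff idx_suc_le_iff not_le\<close>)
  then show ?thesis by (metis less_asym linorder_neqE less_irrefl)
qed

lemma basis_eq_iff [simp]: "basis i = basis j \<longleftrightarrow> i = j"
  by (metis basis_less_iff linorder_neqE less_irrefl)

lemma basis_pos: "0 < basis i"
  by (rule lgrp_lessI[of idx_zero]) auto

section \<open>The asymptotic couple\<close>

text \<open>\<open>least_support\<close> makes the \<open>LEAST\<close> meaningful for
  \<open>g \<noteq> 0\<close>; \<open>lead 0\<close> is unspecified.\<close>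

definition lead :: "lgrp \<Rightarrow> idx" where
  "lead g = (LEAST k. coef g k \<noteq> 0)"

lemma lead_eqI: "coef g n \<noteq> 0 \<Longrightarrow> (\<And>k. k < n \<Longrightarrow> coef g k = 0) \<Longrightarrow> lead g = n"
  unfolding lead_def by (rule Least_equality) (auto simp: not_less[symmetric])

lemma
  assumes "g \<noteq> 0"
  shows coef_lead: "coef g (lead g) \<noteq> 0"
    and coef_below_lead: "k < lead g \<Longrightarrow> coef g k = 0"
proof -
  obtain k where "coef g k \<noteq> 0" using assms lgrp_eqI[of g 0] by auto
  then obtain n where n: "coef g n \<noteq> 0" "\<And>l. l < n \<Longrightarrow> coef g l = 0"
    by (rule least_support) blast
  then have "lead g = n" by (rule lead_eqI)
  with n show "coef g (lead g) \<noteq> 0" "k < lead g \<Longrightarrow> coef g k = 0" for k by auto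
qed

lemma lead_le: "coef g k \<noteq> 0 \<Longrightarrow> lead g \<le> k"
  using coef_below_lead[of g k] by (metis coef_simps(1) linorder_not_le)

lemma lead_smul: "c \<noteq> 0 \<Longrightarrow> g \<noteq> 0 \<Longrightarrow> lead (smul c g) = lead g"
  by (rule lead_eqI) (auto simp: coef_lead coef_below_lead)

lemma lead_uminus [simp]: "lead (- g) = lead g"
  by (simp add: lead_def)

text \<open>At \<open>lead (g + h)\<close> one of the summands must have a nonzero
  coefficient.\<close>

lemma lead_add: "g + h \<noteq> 0 \<Longrightarrow> min (lead g) (lead h) \<le> lead (g + h)"
  using coef_lead[of "g + h"] lead_le[of g "lead (g + h)"] lead_le[of h "lead (g + h)"]
  by (cases "coef g (lead (g + h)) = 0") (auto simp: min_le_iff_disj)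

lemma coef_lead_pos:
  assumes "0 < g"
  shows "0 < coef g (lead g)"
proof -
  obtain n where n: "\<forall>k<n. coef g k = 0" "0 < coef g n"
    using assms by (auto simp: less_lgrp_def)
  then have "lead g = n" by (intro lead_eqI) auto
  with n show ?thesis by simp
qed

text \<open>Otherwise \<open>h\<close> vanishes up to and including \<open>lead g\<close>, where
  \<open>g\<close> has its first nonzero coefficient, a positive one; then
  \<open>h < g\<close>.\<close>

lemma lead_antimono:
  assumes "0 < g" "g \<le> h"
  shows "lead h \<le> lead g"
proof (rule ccontr)
  assume "\<not> lead h \<le> lead g"
  then have "lead g < lead h" by simp
  have "h < g"
  proof (rule lgrp_lessI[of "lead g"])
    have "h \<noteq> 0" using assms by auto
    then show "coef h (lead g) < coef g (lead g)"
      using coef_lead_pos[OF assms(1)] coef_below_lead[of h] \<open>lead g < lead h\<close> by simp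
    show "coef h k = coef g k" if "k < lead g" for k
      using that \<open>lead g < lead h\<close> \<open>h \<noteq> 0\<close> assms(1) coef_below_lead[of g k] coef_below_lead[of h k]
      by auto
  qed
  with assms(2) show False by simp
qed

text \<open>The right side is 1 below \<open>lead g\<close> and exceeds 1 at \<open>lead g\<close>,
  while \<open>basis i\<close> never exceeds 1.\<close>

lemma basis_less_derivative:
  assumes "0 < g"
  shows "basis i < g + basis (lead g)"
proof -
  have g: "\<And>k. k < lead g \<Longrightarrow> coef g k = 0" "0 < coef g (lead g)"
    using assms coef_below_lead[of g] coef_lead_pos by auto
  show ?thesis
  proof (cases "i < lead g")
    case True
    then have "0 \<le> coef g (idx_suc i)"
      using g by (cases "idx_suc i = lead g") (auto simp: idx_suc_le_iff order.strict_iff_order)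
    with True g show ?thesis
      by (intro lgrp_lessI[of "idx_suc i"]) (auto simp: less_idx_suc_iff idx_suc_le_iff not_le)
  next
    case False
    show ?thesis
      by (rule lgrp_lessI[of "lead g"]) (use False g in auto)
  qed
qed

section \<open>Asymptotic integration and the successor map\<close>

lemma coef_neq_one:
  obtains k where "coef g k \<noteq> 1"
proof -
  obtain xs where xs: "coef g = combo xs" using coef[of g] by auto
  \<comment> \<open>A point above every index of the combination, where all its indicators
    vanish.\<close>
  define k where "k = Max (insert idx_zero (idx_suc ` snd ` set xs))"
  have "q * initial i k = 0" if "(q, i) \<in> set xs" for q i
  proof -
    have "idx_suc i \<le> k" unfolding k_def using that by (intro Max_ge) force+
    then show ?thesis by (auto simp: initial_def idx_suc_le_iff)
  qed
  then have "map (\<lambda>(q, i). q * initial i k) xs = map (\<lambda>_. 0) xs" by auto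
  then have "coef g k = 0" unfolding xs combo_def by (simp only: sum_list_0)
  with that show thesis by force
qed

text \<open>A derivative \<open>h + basis (lead h)\<close> is 1 below \<open>lead h\<close> and
  differs from 1 at \<open>lead h\<close>. Hence this index is the lead of the integral of
  \<open>g\<close>, and \<open>basis (int_lead g)\<close> is \<open>s\<close> of
  \<open>g\<close>.\<close>

definition int_lead :: "lgrp \<Rightarrow> idx" where
  "int_lead g = (LEAST k. coef g k \<noteq> 1)"

lemma int_lead_eqI: "coef g n \<noteq> 1 \<Longrightarrow> (\<And>k. k < n \<Longrightarrow> coef g k = 1) \<Longrightarrow> int_lead g = n"
  unfolding int_lead_def by (rule Least_equality) (auto simp: not_less[symmetric])

lemma int_lead_derivative: "g \<noteq> 0 \<Longrightarrow> int_lead (g + basis (lead g)) = lead g"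
  by (rule int_lead_eqI) (auto simp: coef_lead coef_below_lead)

lemma derivative_surj:
  obtains h where "h \<noteq> 0" "h + basis (lead h) = g"
proof -
  obtain k where k: "coef g k \<noteq> 1" by (rule coef_neq_one)
  \<comment> \<open>Up to \<open>k\<close> the function \<open>g - basis k\<close> is
    \<open>g\<close> minus 1, so its least support element \<open>n\<close> is the first place where
    \<open>g\<close> differs from 1. The integral is then \<open>g - basis n\<close>.\<close>
  then have "coef (g - basis k) k \<noteq> 0" by simp
  then obtain n where n: "n \<le> k" "coef (g - basis k) n \<noteq> 0" "\<And>l. l < n \<Longrightarrow> coef (g - basis k) l = 0"
    by (rule least_support) blast
  have "lead (g - basis n) = n"
    by (rule lead_eqI) (use n in \<open>auto split: if_splits\<close>)
  moreover have "coef (g - basis n) n \<noteq> 0" using n by simp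
  then have "g - basis n \<noteq> 0" by (metis coef_simps(1))
  ultimately show thesis using that[of "g - basis n"] by simp
qed

text \<open>\<open>int_lead\<close> recovers the lead from the derivative, so both leads agree and
  their basis elements cancel.\<close>

lemma derivative_inj:
  assumes "g \<noteq> 0" "h \<noteq> 0" "g + basis (lead g) = h + basis (lead h)"
  shows "g = h"
  using assms int_lead_derivative by (metis add_right_cancel)

lemma int_lead_zero [simp]: "int_lead 0 = idx_zero"
  by (rule int_lead_eqI) auto

text \<open>This makes \<open>s\<close> act on \<Psi> as \<open>idx_suc\<close> acts on
  indices.\<close>

lemma int_lead_basis [simp]: "int_lead (basis i) = idx_suc i"
  by (rule int_lead_eqI) (auto simp: less_idx_suc_iff not_le)

text \<open>The indicator of \<open>{k}\<close>. For \<open>k \<noteq> idx_zero\<close> it equals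
  \<psi> x - p(\<psi> x) for every x with lead \<open>k\<close>.\<close>

definition unit :: "idx \<Rightarrow> lgrp" where
  "unit k = (if k = idx_zero then basis k else basis k - basis (THE l. k = idx_suc l))"

lemma coef_unit [simp]: "coef (unit k) l = (if l = k then 1 else 0)"
proof (cases "k = idx_zero")
  case True
  then show ?thesis by (auto simp: unit_def antisym)
next
  case False
  then obtain j where "k = idx_suc j" by (rule idx_suc_exhaust)
  then show ?thesis
    by (auto simp: unit_def le_idx_suc_iff idx_suc_le_iff)
qed

lemma lead_unit [simp]: "lead (unit k) = k"
  by (rule lead_eqI) auto

lemma basis_in_range_lead: "\<exists>g. g \<noteq> 0 \<and> basis (lead g) = basis k"
  by (rule exI[of _ "unit k"]) (metis coef_simps(1) coef_unit lead_unit zero_neq_one)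


section \<open>The model\<close>

text \<open>\<open>None\<close> is \<infinity>, propagated by \<open>bind\<close> and
  \<open>map_option\<close>. \<open>F_p\<close> is finite exactly at the basis elements of
  successors, which form \<Psi> above s(0).\<close>

primrec lfun :: "log_fun \<Rightarrow> lgrp option list \<Rightarrow> lgrp option" where
  "lfun F_zero xs = Some 0"
| "lfun F_infty xs = None"
| "lfun F_plus xs = Option.bind (xs ! 0) (\<lambda>g. map_option ((+) g) (xs ! 1))"
| "lfun F_minus xs = map_option uminus (xs ! 0)"
| "lfun F_psi xs = Option.bind (xs ! 0) (\<lambda>g. if g = 0 then None else Some (basis (lead g)))"
| "lfun F_s xs = map_option (\<lambda>g. basis (int_lead g)) (xs ! 0)"
| "lfun F_p xs = Option.bind (xs ! 0) (\<lambda>g. if \<exists>k. g = basis (idx_suc k)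
     then Some (basis (THE k. g = basis (idx_suc k))) else None)"
| "lfun (F_delta n) xs = map_option (smul (1 / of_nat (Suc n))) (xs ! 0)"

definition less_infty :: "lgrp option \<Rightarrow> lgrp option \<Rightarrow> bool" where
  "less_infty x y = (case x of None \<Rightarrow> False | Some g \<Rightarrow> (case y of None \<Rightarrow> True | Some h \<Rightarrow> g < h))"

lemma less_infty_simps [simp]:
  "\<not> less_infty None y"
  "less_infty (Some g) None"
  "less_infty (Some g) (Some h) \<longleftrightarrow> g < h"
  by (simp_all add: less_infty_def)

definition M_log :: "(log_fun, log_rel, lgrp option) struct" where
  "M_log = \<lparr>dom = UNIV, fun_interp = lfun, rel_interp = (\<lambda>_ xs. less_infty (xs ! 0) (xs ! 1))\<rparr>"

lemma M_log_simps [simp]: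
  "dom M_log = UNIV"
  "fun_interp M_log = lfun"
  "rel_interp M_log r xs = less_infty (xs ! 0) (xs ! 1)"
  by (simp_all add: M_log_def)

lemma val_t_mult: "val M_log e t = Some g \<Longrightarrow> val M_log e (t_mult n t) = Some (smul (of_nat n) g)"
proof (induction n)
  case 0
  then show ?case by (auto intro: lgrp_eqI)
next
  case (Suc n)
  then show ?case by (simp add: smul_Suc del: of_nat_Suc)
qed

lemma smul_Suc_delta: "smul (of_nat (Suc n)) (smul (1 / of_nat (Suc n)) g) = g"
  by (rule lgrp_eqI) (simp del: of_nat_Suc)

lemma smul_eq_0_iff: "c \<noteq> 0 \<Longrightarrow> smul c g = 0 \<longleftrightarrow> g = 0"
  by (metis (no_types, lifting) coef_simps(1,5) lgrp_eqI mult_eq_0_iff)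

lemma sat_ordered_group: "A \<in> ax_ordered_group \<Longrightarrow> sat M_log e A"
  unfolding ax_ordered_group_def by (auto simp: split_option_all add.assoc add.commute)

lemma sat_infty_default: "A \<in> ax_infty_default \<Longrightarrow> sat M_log e A"
  unfolding ax_infty_default_def by auto

lemma sat_divisible: "A \<in> ax_divisible \<Longrightarrow> sat M_log e A"
  unfolding ax_divisible_def
  \<comment> \<open>\<open>t_mult (Suc n)\<close> and \<open>of_nat (Suc n)\<close> stay folded so
    that \<open>val_t_mult\<close> matches and the factor cancels.\<close>
  by (auto simp: split_option_all val_t_mult smul_Suc_delta simp del: t_mult.simps of_nat_Suc)

lemma sat_H_asymptotic_couple: "A \<in> ax_H_asymptotic_couple \<Longrightarrow> sat M_log e A"
proof -
  \<comment> \<open>\<open>f_le\<close> unfolds to strict or equal; \<open>add\<close> and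
    \<open>anti\<close> supply the strict case left when the other alternatives fail.\<close>
  have add: "lead h < lead (g + h)"
    if "g + h \<noteq> 0" "lead g \<noteq> lead (g + h)" "lead h \<noteq> lead (g + h)" "\<not> lead g < lead (g + h)" for g h
    using lead_add[of g h] that by (auto simp: min_le_iff_disj)
  have anti: "lead h < lead g" if "0 < g" "g < h" "lead h \<noteq> lead g" for g h
    using lead_antimono[of g h] that by (simp add: order.strict_iff_order)
  show "A \<in> ax_H_asymptotic_couple \<Longrightarrow> sat M_log e A"
    unfolding ax_H_asymptotic_couple_def
    by (auto simp: split_option_all val_t_mult lead_smul smul_eq_0_iff basis_less_derivative
        intro: add anti simp del: t_mult.simps of_nat_Suc)
qed

lemma sat_asymptotic_integration: "A \<in> ax_asymptotic_integration \<Longrightarrow> sat M_log e A"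
proof -
  have int: "\<exists>h. h \<noteq> 0 \<and> (h \<noteq> 0 \<longrightarrow>
      h + basis (lead h) = g \<and> (\<forall>u. u \<noteq> 0 \<longrightarrow> u + basis (lead u) = g \<longrightarrow> u = h))" for g
    using derivative_surj[of g] derivative_inj by metis
  show "A \<in> ax_asymptotic_integration \<Longrightarrow> sat M_log e A"
    unfolding ax_asymptotic_integration_def
    by (auto simp: split_option_all split_option_ex int_lead_derivative int)
qed

section \<open>Coincidence lemmas and the interpretation of \<Psi>\<close>

lemma val_cong: "(\<And>v. v \<in> fv_trm t \<Longrightarrow> e v = e' v) \<Longrightarrow> val M e t = val M e' t"
proof (induction t)
  case (Fn f ts)
  then have "map (val M e) ts = map (val M e') ts" by auto
  then show ?case by (metis val.simps(2))
qed simp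

lemma sat_cong: "(\<And>v. v \<in> fv_fm A \<Longrightarrow> e v = e' v) \<Longrightarrow> sat M e A \<longleftrightarrow> sat M e' A"
proof (induction A arbitrary: e e')
  case (Eq t u)
  then have "val M e t = val M e' t" "val M e u = val M e' u" by (auto intro!: val_cong)
  then show ?case by simp
next
  case (Rel r ts)
  then have "map (val M e) ts = map (val M e') ts" by (auto intro!: val_cong)
  then show ?case by (metis sat.simps(2))
next
  case (Neg A)
  then show ?case by (metis fv_fm.simps(3) sat.simps(3))
next
  case (Conj A B)
  then show ?case by (metis UnCI fv_fm.simps(4) sat.simps(4))
next
  case (Exi v A)
  have "sat M (e(v := d)) A \<longleftrightarrow> sat M (e'(v := d)) A" for d
    by (rule Exi.IH) (use Exi.prems in auto)
  then show ?case by simp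
qed

text \<open>Binding variable 9 leaves the value of \<open>t\<close> unchanged, and every index is
  the lead of its unit vector, so \<Psi> consists of all basis elements.\<close>

lemma sat_in_\<Psi>:
  assumes "9 \<notin> fv_trm t"
  shows "sat M_log e (in_\<Psi> t) \<longleftrightarrow> (\<exists>k. val M_log e t = Some (basis k))"
proof -
  have "val M_log (e(9 := d)) t = val M_log e t" for d
    using assms by (intro val_cong) auto
  then have "sat M_log e (in_\<Psi> t) \<longleftrightarrow> (\<exists>g. g \<noteq> 0 \<and> Some (basis (lead g)) = val M_log e t)"
    by (auto simp: split_option_ex split: if_splits)
  also have "\<dots> \<longleftrightarrow> (\<exists>k. val M_log e t = Some (basis k))"
    using basis_in_range_lead by metis
  finally show ?thesis .
qed

text \<open>The side condition keeps the simplifier from unfolding \<open>in_\<Psi>\<close> before \<open>sat_in_\<Psi>\<close> applies.\<close>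

lemma sat_Exi_M_log: "v \<noteq> 9 \<Longrightarrow> sat M_log e (Exi v A) \<longleftrightarrow> (\<exists>d. sat M_log (e(v := d)) A)"
  by simp

lemma sat_\<Psi>: "A \<in> ax_\<Psi> \<Longrightarrow> sat M_log e A"
proof -
  \<comment> \<open>The axioms compare with s(0), that is with \<open>idx_zero\<close>, whereas
    \<open>F_p\<close> asks for a successor; \<open>pos\<close> identifies the two
    conditions.\<close>
  have pos: "idx_zero < k \<longleftrightarrow> (\<exists>l. k = idx_suc l)" for k
    by (metis idx_suc_exhaust idx_zero_le idx_zero_neq_suc order.strict_iff_order)
  have zero: "idx_zero = k \<longleftrightarrow> (\<forall>l. k \<noteq> idx_suc l)" for k
    using idx_suc_exhaust[of k] by (metis idx_zero_neq_suc)
  have suc: "idx_suc k < l \<longleftrightarrow> k < l \<and> idx_suc k \<noteq> l" for k l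
    by (metis idx_suc_le_iff order.strict_iff_order)
  have ex_zero: "\<exists>k. \<forall>l. k \<noteq> idx_suc l"
    using idx_zero_neq_suc by blast
  \<comment> \<open>Surjectivity of \<open>s\<close> onto \<Psi> above s(0): the preimage of
    \<open>basis (idx_suc l)\<close> is \<open>basis l\<close>.\<close>
  have ex_pred: "\<not> (\<forall>g. (\<forall>k. g \<noteq> basis k) \<or> int_lead g \<noteq> idx_suc l)" for l
    using int_lead_basis by blast
  show "A \<in> ax_\<Psi> \<Longrightarrow> sat M_log e A"
    unfolding ax_\<Psi>_def
    by (auto simp: sat_in_\<Psi> sat_Exi_M_log basis_pos pos zero suc ex_zero ex_pred split_option_all
        split_option_ex split: if_splits simp del: sat.simps(5))
qed

lemma is_model_M_log: "is_model L_log M_log T_log"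
  unfolding is_model_def is_struct_def T_log_def
  using sat_ordered_group sat_infty_default sat_divisible sat_H_asymptotic_couple
    sat_asymptotic_integration sat_\<Psi>
  by auto

section \<open>Transport of ict-patterns\<close>

lemma consistent_type_mono: "consistent_type M m p \<Longrightarrow> q \<subseteq> p \<Longrightarrow> consistent_type M m q"
  unfolding consistent_type_def by blast

text \<open>Discarding rows only shrinks the type of each path, so one pattern of infinite depth
  yields all depths.\<close>

lemma ict_pattern_mono:
  assumes "ict_pattern L M m \<kappa> \<phi> k a" "\<kappa>' \<le> \<kappa>"
  shows "ict_pattern L M m \<kappa>' \<phi> k a"
proof -
  have less: "enat i < \<kappa>" if "enat i < \<kappa>'" for i
    using that assms(2) by (rule less_le_trans)
  have "consistent_type M m ({(\<phi> i, a i (\<eta> i)) | i. enat i < \<kappa>'} \<union>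
         {(Neg (\<phi> i), a i j) | i j. enat i < \<kappa>' \<and> j \<noteq> \<eta> i})" for \<eta>
    using assms(1) unfolding ict_pattern_def
    by (elim conjE allE[of _ \<eta>], elim consistent_type_mono) (use less in blast)
  then show ?thesis
    using assms(1) less unfolding ict_pattern_def by blast
qed

text \<open>For injective \<open>h\<close>, the isomorphic copy of \<open>M\<close> in another type.
  \<open>inv h\<close> inverts \<open>h\<close> only on \<open>range h\<close>, so the environments
  considered below factor through \<open>h\<close>.\<close>

definition image_struct :: "('a \<Rightarrow> 'b) \<Rightarrow> ('f, 'r, 'a) struct \<Rightarrow> ('f, 'r, 'b) struct" where
  "image_struct h M = \<lparr>dom = h ` dom M,
     fun_interp = (\<lambda>f xs. h (fun_interp M f (map (inv h) xs))),
     rel_interp = (\<lambda>r xs. rel_interp M r (map (inv h) xs))\<rparr>"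

lemma image_struct_simps [simp]:
  "dom (image_struct h M) = h ` dom M"
  "fun_interp (image_struct h M) f xs = h (fun_interp M f (map (inv h) xs))"
  "rel_interp (image_struct h M) r xs = rel_interp M r (map (inv h) xs)"
  by (simp_all add: image_struct_def)

lemma val_image_struct:
  assumes "inj h"
  shows "val (image_struct h M) (\<lambda>v. h (e v)) t = h (val M e t)"
proof (induction t)
  case (Fn f ts)
  then have "map (inv h) (map (val (image_struct h M) (\<lambda>v. h (e v))) ts) = map (val M e) ts"
    using assms by (auto simp: inv_f_f)
  then show ?case by (simp only: val.simps image_struct_simps)
qed simp

lemma sat_image_struct:
  assumes "inj h"
  shows "sat (image_struct h M) (\<lambda>v. h (e v)) A \<longleftrightarrow> sat M e A"
proof (induction A arbitrary: e)
  case (Eq t u)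
  then show ?case using assms by (simp add: val_image_struct inj_eq)
next
  case (Rel r ts)
  have "map (inv h) (map (val (image_struct h M) (\<lambda>v. h (e v))) ts) = map (val M e) ts"
    using assms by (auto simp: inv_f_f val_image_struct)
  then show ?case by (simp only: sat.simps image_struct_simps)
next
  case (Exi v A)
  have "sat (image_struct h M) ((\<lambda>u. h (e u))(v := h d)) A \<longleftrightarrow> sat M (e(v := d)) A" for d
  proof -
    have "(\<lambda>u. h (e u))(v := h d) = (\<lambda>u. h ((e(v := d)) u))" by auto
    then show ?thesis using Exi.IH[of "e(v := d)"] by metis
  qed
  then show ?case by simp
next
  case (Neg A)
  then show ?case by (simp only: sat.simps)
next
  case (Conj A B)
  then show ?case by (simp only: sat.simps)
qed

lemma is_model_image_struct:
  assumes "inj h" "is_model L M T"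
  shows "is_model L (image_struct h M) T"
proof -
  have M: "is_struct L M" using assms(2) by (simp add: is_model_def)
  have "fun_interp (image_struct h M) f xs \<in> h ` dom M"
    if "length xs = fun_arity L f" "set xs \<subseteq> h ` dom M" for f xs
  proof -
    have "set (map (inv h) xs) \<subseteq> dom M" using that(2) assms(1) by (auto simp: inv_f_f)
    then have "fun_interp M f (map (inv h) xs) \<in> dom M"
      using M that(1) unfolding is_struct_def by (metis length_map)
    then show ?thesis by simp
  qed
  then have "is_struct L (image_struct h M)"
    using M by (simp add: is_struct_def)
  moreover have "sat (image_struct h M) e A"
    if "A \<in> T" and e: "range e \<subseteq> h ` dom M" for A e
  proof -
    have "h (inv h (e v)) = e v" "inv h (e v) \<in> dom M" for v
    proof -
      have "e v \<in> h ` dom M" using e by blast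
      then obtain d where "d \<in> dom M" "e v = h d" by blast
      then show "h (inv h (e v)) = e v" "inv h (e v) \<in> dom M"
        using assms(1) by (simp_all add: inv_f_f)
    qed
    then have "(\<lambda>v. h (inv h (e v))) = e" "range (\<lambda>v. inv h (e v)) \<subseteq> dom M" by auto
    moreover from this have "sat M (\<lambda>v. inv h (e v)) A"
      using that(1) assms(2) unfolding is_model_def by blast
    ultimately show ?thesis
      using sat_image_struct[OF assms(1), of M "\<lambda>v. inv h (e v)" A] by simp
  qed
  ultimately show ?thesis by (simp add: is_model_def)
qed

text \<open>\<open>map h xs ! v\<close> is known to be \<open>h (xs ! v)\<close> only for
  \<open>v < length xs\<close>, hence the bound on the free variables.\<close>

lemma sat_image_struct_nth:
  assumes "inj h" "fv_fm A \<subseteq> {..<length xs}"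
  shows "sat (image_struct h M) ((!) (map h xs)) A \<longleftrightarrow> sat M ((!) xs) A"
proof -
  have "sat (image_struct h M) ((!) (map h xs)) A \<longleftrightarrow> sat (image_struct h M) (\<lambda>v. h (xs ! v)) A"
    by (rule sat_cong) (use assms(2) in auto)
  then show ?thesis using sat_image_struct[OF assms(1)] by simp
qed

text \<open>A finite part of the image is the image of a finite part, and \<open>h\<close> carries
  realisations along.\<close>

lemma consistent_type_image_struct:
  assumes "inj h" "consistent_type M m p" "\<And>A c. (A, c) \<in> p \<Longrightarrow> fv_fm A \<subseteq> {..<m + length c}"
  shows "consistent_type (image_struct h M) m ((\<lambda>(A, c). (A, map h c)) ` p)"
  unfolding consistent_type_def
proof (intro allI impI)
  fix q
  assume q: "finite q \<and> q \<subseteq> (\<lambda>(A, c). (A, map h c)) ` p"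
  obtain r where r: "r \<subseteq> p" "finite r" "q = (\<lambda>(A, c). (A, map h c)) ` r"
    using finite_subset_image[OF q[THEN conjunct1] q[THEN conjunct2]] by blast
  with assms(2) obtain b where b: "length b = m" "set b \<subseteq> dom M" "\<forall>(A, c)\<in>r. sat M ((!) (b @ c)) A"
    unfolding consistent_type_def by blast
  have "sat (image_struct h M) ((!) (map h b @ map h c)) A" if "(A, c) \<in> r" for A c
  proof -
    have "fv_fm A \<subseteq> {..<length (b @ c)}" using assms(3) r(1) b(1) that by auto
    moreover have "sat M ((!) (b @ c)) A" using b(3) that by blast
    ultimately show ?thesis
      using sat_image_struct_nth[OF assms(1), of A "b @ c" M] by (simp only: map_append)
  qed
  then have "\<forall>(A, c)\<in>q. sat (image_struct h M) ((!) (map h b @ c)) A"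
    unfolding r(3) by clarsimp
  then show "\<exists>b. length b = m \<and> set b \<subseteq> dom (image_struct h M) \<and>
      (\<forall>(A, c)\<in>q. sat (image_struct h M) ((!) (b @ c)) A)"
    using b(1,2) by (intro exI[of _ "map h b"]) (simp add: image_mono)
qed

lemma ict_pattern_image_struct:
  assumes "inj h" "ict_pattern L M m \<kappa> \<phi> k a"
  shows "ict_pattern L (image_struct h M) m \<kappa> \<phi> k (\<lambda>i j. map h (a i j))"
proof -
  have rows: "wf_fm L (\<phi> i)" "fv_fm (\<phi> i) \<subseteq> {..<m + k i}" "length (a i j) = k i" "set (a i j) \<subseteq> dom M"
    if "enat i < \<kappa>" for i j
    using assms(2) that unfolding ict_pattern_def by blast+
  have "consistent_type (image_struct h M) m
      ({(\<phi> i, map h (a i (\<eta> i))) | i. enat i < \<kappa>} \<union>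
       {(Neg (\<phi> i), map h (a i j)) | i j. enat i < \<kappa> \<and> j \<noteq> \<eta> i})" for \<eta>
  proof (rule consistent_type_mono)
    let ?p = "{(\<phi> i, a i (\<eta> i)) | i. enat i < \<kappa>} \<union>
       {(Neg (\<phi> i), a i j) | i j. enat i < \<kappa> \<and> j \<noteq> \<eta> i}"
    have "consistent_type M m ?p"
      using assms(2) unfolding ict_pattern_def by blast
    moreover have "fv_fm A \<subseteq> {..<m + length c}" if "(A, c) \<in> ?p" for A c
    proof -
      from that obtain i j where "enat i < \<kappa>" "c = a i j" "fv_fm A = fv_fm (\<phi> i)" by auto
      then show ?thesis using rows(2,3) by simp
    qed
    ultimately show "consistent_type (image_struct h M) m ((\<lambda>(A, c). (A, map h c)) ` ?p)"
      by (rule consistent_type_image_struct[OF assms(1)])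
  qed force
  then show ?thesis
    using rows unfolding ict_pattern_def by (simp add: image_mono)
qed

section \<open>The ict-pattern\<close>

primrec t_peel :: "nat \<Rightarrow> ltrm" where
  "t_peel 0 = X"
| "t_peel (Suc i) = t_peel i \<oplus> t_minus (t_psi (t_peel i) \<oplus> t_minus (t_p (t_psi (t_peel i))))"

lemma wf_t_peel: "wf_trm L_log (t_peel i)"
  by (induction i) (auto simp: L_log_def)

lemma fv_t_peel: "fv_trm (t_peel i) = {0}"
  by (induction i) auto

lemma coef_sum: "coef (sum f A) k = (\<Sum>a\<in>A. coef (f a) k)"
  by (induction A rule: infinite_finite_induct) auto

text \<open>As \<open>c\<close> increases strictly, \<open>c i\<close> is the smallest support
  element of the tail sum, with coefficient 1.\<close>

lemma lead_sum_unit: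
  fixes c :: "nat \<Rightarrow> idx"
  assumes "strict_mono c" "i < n"
  shows "lead (\<Sum>r=i..<n. unit (c r)) = c i"
    and "(\<Sum>r=i..<n. unit (c r)) \<noteq> 0"
proof -
  let ?g = "\<Sum>r=i..<n. unit (c r)"
  have "coef ?g (c i) = (\<Sum>r=i..<n. if r = i then 1 else 0)"
    using strict_mono_eq[OF assms(1), of i] by (auto simp: coef_sum intro!: sum.cong)
  then have 1: "coef ?g (c i) = 1" using assms(2) by simp
  moreover have "coef ?g k = 0" if "k < c i" for k
  proof -
    have "k \<noteq> c r" if "i \<le> r" for r
      using strict_mono_mono[OF assms(1)] monoD[of c i r] that \<open>k < c i\<close> by force
    then show ?thesis unfolding coef_sum by (intro sum.neutral) auto
  qed
  ultimately show "lead ?g = c i" by (intro lead_eqI) auto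
  show "?g \<noteq> 0" using 1 by force
qed

text \<open>For \<open>i < n\<close>, \<psi> of the current sum is \<open>basis (c i)\<close> and
  \<open>p\<close> of that is the preceding basis element, so one step subtracts exactly
  \<open>unit (c i)\<close>. At \<open>idx_zero\<close>, \<open>p\<close> would give
  \<infinity>.\<close>

lemma val_t_peel:
  assumes "strict_mono c" "\<And>r. c r \<noteq> idx_zero" "e 0 = Some (\<Sum>r<n. unit (c r))" "i \<le> n"
  shows "val M_log e (t_peel i) = Some (\<Sum>r=i..<n. unit (c r))"
  using assms(4)
proof (induction i)
  case 0
  then show ?case using assms(3) by (simp add: lessThan_atLeast0)
next
  case (Suc i)
  obtain l where l: "c i = idx_suc l" using assms(2) idx_suc_exhaust by blast
  have "unit (c i) = basis (c i) - basis l"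
    by (simp add: unit_def l idx_zero_neq_suc[symmetric])
  then have "(\<Sum>r=i..<n. unit (c r)) = basis (c i) - basis l + (\<Sum>r=Suc i..<n. unit (c r))"
    using Suc.prems by (simp add: sum.atLeast_Suc_lessThan)
  then show ?case
    using Suc lead_sum_unit[OF assms(1), of i n] l by simp
qed

lemma ict_pattern_M_log:
  "ict_pattern L_log M_log 1 \<infinity> (\<lambda>i. t_psi (t_peel i) \<^bold>= Y) (\<lambda>_. 1) (\<lambda>i j. [Some (basis (idx_cell i j))])"
  unfolding ict_pattern_def
proof (intro conjI allI impI)
  fix i j
  show "wf_fm L_log (t_psi (t_peel i) \<^bold>= Y)" by (simp add: wf_t_peel) (simp add: L_log_def)
  show "fv_fm (t_psi (t_peel i) \<^bold>= Y) \<subseteq> {..<1 + 1}" by (auto simp: fv_t_peel)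
  show "length [Some (basis (idx_cell i j))] = 1" by simp
  show "set [Some (basis (idx_cell i j))] \<subseteq> dom M_log" by simp
next
  fix \<eta> :: "nat \<Rightarrow> nat"
  let ?\<phi> = "\<lambda>i. t_psi (t_peel i) \<^bold>= Y" and ?a = "\<lambda>i j. [Some (basis (idx_cell i j))]"
  define p where "p = {(?\<phi> i, ?a i (\<eta> i)) | i. enat i < \<infinity>} \<union>
    {(Neg (?\<phi> i), ?a i j) | i j. enat i < \<infinity> \<and> j \<noteq> \<eta> i}"
  \<comment> \<open>Only the row index is bounded: all negated instances of the first
    \<open>n\<close> rows stay, and a single point realises them.\<close>
  define p_below where "p_below n = {(?\<phi> i, ?a i (\<eta> i)) | i. i < n} \<union>
    {(Neg (?\<phi> i), ?a i j) | i j. i < n \<and> j \<noteq> \<eta> i}" for n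
  define c where "c i = idx_cell i (\<eta> i)" for i
  \<comment> \<open>The rows lie in successive copies of \<zeta>, so \<open>c\<close> increases
    strictly whatever \<eta> is.\<close>
  have c: "strict_mono c" "\<And>r. c r \<noteq> idx_zero"
    by (auto simp: c_def strict_mono_def idx_cell_less idx_cell_neq_zero)
  have "consistent_type M_log 1 p"
    unfolding consistent_type_def
  proof (intro allI impI)
    fix q
    assume q: "finite q \<and> q \<subseteq> p"
    have mono: "p_below m \<subseteq> p_below n" if "m \<le> n" for m n
      using that less_le_trans unfolding p_below_def by blast
    have "\<exists>n. q \<subseteq> p_below n"
      using q[THEN conjunct1] q[THEN conjunct2]
    proof (induction q rule: finite_induct)
      case (insert A q)
      then obtain n where "q \<subseteq> p_below n" by auto
      moreover obtain m where "A \<in> p_below m"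
        using insert.prems unfolding p_def p_below_def by blast
      ultimately have "insert A q \<subseteq> p_below (max m n)"
        using mono[of m "max m n"] mono[of n "max m n"] by auto
      then show ?case by blast
    qed simp
    then obtain n where n: "q \<subseteq> p_below n" by blast
    \<comment> \<open>This marks the chosen cell in each of the first \<open>n\<close> rows. Marking
      all rows would need infinitely many jumps, which no element of \<open>lgrp\<close>
      has.\<close>
    let ?x = "Some (\<Sum>r<n. unit (c r))"
    have psi: "val M_log ((!) ([?x] @ [y])) (t_psi (t_peel i)) = Some (basis (c i))" if "i < n" for i y
      using that val_t_peel[OF c, of "(!) ([?x] @ [y])" n i] lead_sum_unit[OF c(1) that] by simp
    have "sat M_log ((!) ([?x] @ d)) A" if Ad: "(A, d) \<in> q" for A d
    proof -
      consider i where "i < n" "A = ?\<phi> i" "d = ?a i (\<eta> i)"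
        | i j where "i < n" "j \<noteq> \<eta> i" "A = Neg (?\<phi> i)" "d = ?a i j"
        using subsetD[OF n Ad] unfolding p_below_def by blast
      then show ?thesis
      proof cases
        case 1
        then show ?thesis using psi[of i "hd d"] by (simp add: c_def)
      next
        case 2
        then show ?thesis using psi[of i "hd d"] by (simp add: c_def idx_cell_inject)
      qed
    qed
    then show "\<exists>b. length b = 1 \<and> set b \<subseteq> dom M_log \<and> (\<forall>(A, c)\<in>q. sat M_log ((!) (b @ c)) A)"
      by (intro exI[of _ "[?x]"]) auto
  qed
  then show "consistent_type M_log 1 ({(?\<phi> i, ?a i (\<eta> i)) | i. enat i < \<infinity>} \<union>
      {(Neg (?\<phi> i), ?a i j) | i j. enat i < \<infinity> \<and> j \<noteq> \<eta> i})"
    unfolding p_def .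
qed

theorem theorem8p1:
  assumes "infinite (UNIV :: 'u set)"
  shows "\<not> strongly_dependent TYPE('u) L_log T_log \<and>
         \<not> dp_minimal TYPE('u) L_log T_log \<and>
         \<not> finite_dp_rank TYPE('u) L_log T_log"
proof -
  obtain f :: "nat \<Rightarrow> 'u" where "inj f"
    using infinite_countable_subset[OF assms] by blast
  \<comment> \<open>The model is countable, so it embeds into any infinite type.\<close>
  then have h: "inj (f \<circ> (to_nat :: lgrp option \<Rightarrow> nat))"
    by (intro inj_compose) auto
  \<comment> \<open>Depth \<infinity> refutes strong dependence, and depth
    \<open>enat (Suc n)\<close> refutes dp-rank at most \<open>n\<close>.\<close>
  have "has_ict_pattern TYPE('u) L_log T_log 1 \<kappa>" for \<kappa>
    unfolding has_ict_pattern_def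
    using is_model_image_struct[OF h is_model_M_log]
      ict_pattern_image_struct[OF h ict_pattern_mono[OF ict_pattern_M_log]]
    by (metis enat_ord_code(3))
  then show ?thesis
    unfolding strongly_dependent_def dp_minimal_def finite_dp_rank_def dp_rank_le_def by blast
qed

end
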